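(* Let $\beta>0$, let $X,Y$ be $\beta$-homogeneous $F$-spaces and let $\varphi: X^{2} \to [0,\infty)$ be a function satisfying $$\Phi(x,y):=\sum_{j=1}^{\infty} 4^{(j-1)\beta}\,\varphi\left(\frac{x}{2^{j}},\frac{y}{2^{j}}\right)<\infty$$ for all $x,y\in X$. Let $f:X^{2}\to Y$ be a mapping satisfying $f(x,0)=f(0,z)=0$ for all $x,z\in X$ and $$\|f(x+y,z+w)+f(x-y,z-w)-2f(x,z)-2f(x,w)\|\le \varphi(x,y)\,\varphi(z,w)$$ for all $x,y,z,w\in X$. Then there exists a unique additive-quadratic mapping $F:X^{2}\to Y$ such that $$\|f(x,z)-F(x,z)\|\le \min\{\Psi(x,x)\,\varphi(z,0),\ \varphi(x,0)\,\Phi(z,z)\}$$ for all $x,z\in X$, where $$\Psi(x,y):=\sum_{j=1}^{\infty}2^{(j-1)\beta}\,\varphi\left(\frac{x}{2^{j}},\frac{y}{2^{j}}\right)$$ for all $x,y\in X$.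
   Context: An $F$-norm on a (complex) linear space $X$ is a function $\|\cdot\|:X\to[0,\infty)$ such that: (1) $\|x\|=0$ iff $x=0$; (2) $\|\lambda x\|=\|x\|$ whenever $|\lambda|=1$; (3) $\|x+y\|\le\|x\|+\|y\|$; (4) $\|\lambda_n x\|\to0$ whenever $\lambda_n\to0$; (5) $\|\lambda x_n\|\to0$ whenever $x_n\to0$; (6) $\|\lambda_n x_n\|\to0$ whenever $\lambda_n\to0$ and $x_n\to0$. An $F$-space is a linear space with an $F$-norm that is complete for the metric $\|x-y\|$. It is $\beta$-homogeneous ($\beta>0$) if $\|tx\|=|t|^{\beta}\|x\|$ for all $x\in X$ and all $t\in\mathbb{C}$. The same $\beta$ is used for $X$ and $Y$, and both $F$-norms are written $\|\cdot\|$. A mapping $F:X^2\to Y$ is called additive-quadratic if $F(x+y,z+w)+F(x-y,z-w)-2F(x,z)-2F(x,w)=0$ for all $x,y,z,w\in X$. *)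

theory Defs
  imports "HOL-Analysis.Analysis"
begin

text \<open>Complex linear spaces are whole types of class \<open>ab_group_add\<close> with an explicit scalar
  multiplication satisfying the locale \<^locale>\<open>vector_space\<close>; the type's own topology (if any)
  plays no role.  Convergence to \<open>0\<close> always means that the F-norm tends to \<open>0\<close>.\<close>

locale F_normed_space = vector_space scale
  for scale :: "complex \<Rightarrow> 'a::ab_group_add \<Rightarrow> 'a" +
  fixes nrm :: "'a \<Rightarrow> real"
  assumes nrm_nonneg: "nrm x \<ge> 0"
    and nrm_eq_0_iff: "nrm x = 0 \<longleftrightarrow> x = 0"
    and nrm_scale_unit: "cmod a = 1 \<Longrightarrow> nrm (scale a x) = nrm x"
    and nrm_triangle: "nrm (x + y) \<le> nrm x + nrm y"
    and nrm_scalar_tendsto: "c \<longlonglongrightarrow> 0 \<Longrightarrow> (\<lambda>n. nrm (scale (c n) x)) \<longlonglongrightarrow> 0"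
    and nrm_vector_tendsto: "(\<lambda>n. nrm (u n)) \<longlonglongrightarrow> 0 \<Longrightarrow> (\<lambda>n. nrm (scale a (u n))) \<longlonglongrightarrow> 0"
    and nrm_scalar_vector_tendsto:
      "c \<longlonglongrightarrow> 0 \<Longrightarrow> (\<lambda>n. nrm (u n)) \<longlonglongrightarrow> 0 \<Longrightarrow> (\<lambda>n. nrm (scale (c n) (u n))) \<longlonglongrightarrow> 0"
begin

lemma nrm_uminus: "nrm (- x) = nrm x"
  using nrm_scale_unit[of "-1" x] by simp

lemma Metric_space_nrm: "Metric_space UNIV (\<lambda>x y. nrm (x - y))"
proof
  fix x y z :: 'a
  show "nrm (x - y) \<ge> 0" by (rule nrm_nonneg)
  show "nrm (x - y) = nrm (y - x)" using nrm_uminus[of "x - y"] by simp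
  show "nrm (x - y) = 0 \<longleftrightarrow> x = y" by (simp add: nrm_eq_0_iff)
  show "nrm (x - z) \<le> nrm (x - y) + nrm (y - z)"
    using nrm_triangle[of "x - y" "y - z"] by simp
qed

end

locale F_space = F_normed_space +
  assumes complete: "Metric_space.mcomplete UNIV (\<lambda>x y. nrm (x - y))"

locale homogeneous_F_space = F_space +
  fixes \<beta> :: real
  assumes beta_pos: "\<beta> > 0"
    and nrm_scale: "nrm (scale t x) = cmod t powr \<beta> * nrm x"

definition additive_quadratic ::
    "(complex \<Rightarrow> 'b \<Rightarrow> 'b) \<Rightarrow> ('a::ab_group_add \<Rightarrow> 'a \<Rightarrow> 'b::ab_group_add) \<Rightarrow> bool" where
  "additive_quadratic scl F \<longleftrightarrow>
    (\<forall>x y z w. F (x + y) (z + w) + F (x - y) (z - w) - scl 2 (F x z) - scl 2 (F x w) = 0)"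

text \<open>The \<open>n\<close>-th term is the summand with index \<open>j = n + 1\<close> of
  \<open>\<Sum>\<^sub>j\<^sub>\<ge>\<^sub>1 b\<^bsup>(j-1)\<beta>\<^esup> \<phi>(x/2\<^sup>j, y/2\<^sup>j)\<close>; the bases \<open>b = 4\<close> and \<open>b = 2\<close> give the
  control functions \<open>\<Phi>\<close> and \<open>\<Psi>\<close>.\<close>

definition control_term ::
    "(complex \<Rightarrow> 'a \<Rightarrow> 'a) \<Rightarrow> real \<Rightarrow> real \<Rightarrow> ('a \<Rightarrow> 'a \<Rightarrow> real) \<Rightarrow> 'a \<Rightarrow> 'a \<Rightarrow> nat \<Rightarrow> real" where
  "control_term scl b \<beta> \<phi> x y n =
    b powr (real n * \<beta>) * \<phi> (scl (1 / 2 ^ Suc n) x) (scl (1 / 2 ^ Suc n) y)"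

definition control_sum ::
    "(complex \<Rightarrow> 'a \<Rightarrow> 'a) \<Rightarrow> real \<Rightarrow> real \<Rightarrow> ('a \<Rightarrow> 'a \<Rightarrow> real) \<Rightarrow> 'a \<Rightarrow> 'a \<Rightarrow> real" where
  "control_sum scl b \<beta> \<phi> x y = (\<Sum>n. control_term scl b \<beta> \<phi> x y n)"

end

theory Submission
  imports Defs
begin

text \<open>Putting \<open>y = x\<close>, \<open>w = 0\<close> in the hypothesis gives
  \<open>\<parallel>f(2x, z) - 2 f(x, z)\<parallel> \<le> \<phi>(x, x) \<phi>(z, 0)\<close>, so \<open>2\<^sup>n f(x/2\<^sup>n, z)\<close> is a Cauchy sequence; its limit \<open>F\<close> is
  additive-quadratic and satisfies the bound with \<open>\<Psi>\<close>.  Putting \<open>y = 0\<close>, \<open>w = z\<close> shows that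
  \<open>4\<^sup>n f(x, z/2\<^sup>n)\<close> stays within \<open>\<phi>(x, 0) \<Phi>(z, z)\<close> of \<open>f(x, z)\<close>; since \<open>F(x, 2z) = 4 F(x, z)\<close>, the
  bound with \<open>\<Psi>\<close> at \<open>(x, z/2\<^sup>n)\<close>, multiplied by \<open>4\<^bsup>n\<beta>\<^esup>\<close>, forces this sequence to converge to the same \<open>F\<close>,
  which gives the second bound.  Any competitor is also the limit of \<open>2\<^sup>n f(x/2\<^sup>n, z)\<close>, because
  \<open>2\<^bsup>n\<beta>\<^esup> \<Psi>(x/2\<^sup>n, x/2\<^sup>n)\<close> is a tail of the series \<open>\<Psi>(x, x)\<close>.\<close>

lemma suminf_tail_tendsto_0:
  fixes a :: "nat \<Rightarrow> real"
  assumes "summable a"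
  shows "(\<lambda>n. \<Sum>k. a (k + n)) \<longlonglongrightarrow> 0"
proof -
  have "(\<lambda>n. suminf a - sum a {..<n}) \<longlonglongrightarrow> suminf a - suminf a"
    by (intro tendsto_intros summable_LIMSEQ assms)
  then show ?thesis
    by (simp add: suminf_minus_initial_segment[OF assms])
qed

text \<open>The same expression is needed for \<open>f\<close>, for its rescalings and for their
  limit: the hypothesis on \<open>f\<close> bounds it, and the equation for \<open>F\<close> says
  that it vanishes.\<close>

definition aq_defect ::
    "(complex \<Rightarrow> 'b \<Rightarrow> 'b) \<Rightarrow> ('a::ab_group_add \<Rightarrow> 'a \<Rightarrow> 'b::ab_group_add) \<Rightarrow> 'a \<Rightarrow> 'a \<Rightarrow> 'a \<Rightarrow> 'a \<Rightarrow> 'b" where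
  "aq_defect scl f x y z w = f (x + y) (z + w) + f (x - y) (z - w) - scl 2 (f x z) - scl 2 (f x w)"

lemma additive_quadratic_iff_defect:
  "additive_quadratic scl F \<longleftrightarrow> (\<forall>x y z w. aq_defect scl F x y z w = 0)"
  by (simp add: additive_quadratic_def aq_defect_def)

section \<open>Convergence in an F-norm and the additive-quadratic equation\<close>

context F_normed_space
begin

lemma nrm_0: "nrm 0 = 0"
  by (simp add: nrm_eq_0_iff)

lemma nrm_minus_commute: "nrm (x - y) = nrm (y - x)"
  using nrm_uminus[of "x - y"] by simp

lemma nrm_diff_triangle: "nrm (x - z) \<le> nrm (x - y) + nrm (y - z)"
  using nrm_triangle[of "x - y" "y - z"] by simp

lemma scale_2: "scale 2 x = x + x"
  using scale_left_distrib[of 1 1 x] by simp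

lemma scale_4: "scale 4 x = x + x + (x + x)"
  using scale_left_distrib[of 2 2 x] by (simp add: scale_2)

text \<open>Telescoping with the triangle inequality. The shifted index \<open>i + m\<close> makes
  the bound a partial sum of the \<open>m\<close>-th tail of \<open>a\<close>; with
  \<open>m = 0\<close> it measures the distance from the starting element.\<close>

lemma nrm_diff_le_sum:
  assumes "\<And>n. nrm (s n - s (Suc n)) \<le> a n"
  shows "nrm (s m - s (m + k)) \<le> (\<Sum>i<k. a (i + m))"
proof (induction k)
  case 0
  then show ?case by (simp add: nrm_0)
next
  case (Suc k)
  have "nrm (s m - s (m + Suc k)) \<le> nrm (s m - s (m + k)) + nrm (s (m + k) - s (Suc (m + k)))"
    using nrm_diff_triangle by simp
  also have "\<dots> \<le> (\<Sum>i<k. a (i + m)) + a (m + k)"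
    by (intro add_mono Suc assms)
  finally show ?case by (simp add: add.commute)
qed

lemma nrm_limit_add:
  assumes "(\<lambda>n. nrm (u n - l)) \<longlonglongrightarrow> 0" "(\<lambda>n. nrm (v n - m)) \<longlonglongrightarrow> 0"
  shows "(\<lambda>n. nrm (u n + v n - (l + m))) \<longlonglongrightarrow> 0"
proof (rule tendsto_sandwich[OF _ _ tendsto_const])
  show "(\<lambda>n. nrm (u n - l) + nrm (v n - m)) \<longlonglongrightarrow> 0"
    using tendsto_add[OF assms] by simp
  have "u n + v n - (l + m) = (u n - l) + (v n - m)" for n by simp
  then show "\<forall>\<^sub>F n in sequentially. nrm (u n + v n - (l + m)) \<le> nrm (u n - l) + nrm (v n - m)"
    by (metis (mono_tags, lifting) nrm_triangle always_eventually)
qed (simp add: nrm_nonneg)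

lemma nrm_limit_scale:
  assumes "(\<lambda>n. nrm (u n - l)) \<longlonglongrightarrow> 0"
  shows "(\<lambda>n. nrm (scale a (u n) - scale a l)) \<longlonglongrightarrow> 0"
  using nrm_vector_tendsto[OF assms, of a] by (simp add: scale_right_diff_distrib)

lemma nrm_limit_diff:
  assumes "(\<lambda>n. nrm (u n - l)) \<longlonglongrightarrow> 0" "(\<lambda>n. nrm (v n - m)) \<longlonglongrightarrow> 0"
  shows "(\<lambda>n. nrm (u n - v n - (l - m))) \<longlonglongrightarrow> 0"
  using nrm_limit_add[OF assms(1) nrm_limit_scale[OF assms(2), of "-1"]] by simp

lemma nrm_limit_unique:
  assumes "(\<lambda>n. nrm (u n - l)) \<longlonglongrightarrow> 0" "(\<lambda>n. nrm (u n - m)) \<longlonglongrightarrow> 0"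
  shows "l = m"
proof -
  have "(\<lambda>n. nrm (l - m)) \<longlonglongrightarrow> 0"
    using nrm_limit_diff[OF assms] by (simp add: nrm_minus_commute)
  then show ?thesis
    by (simp add: LIMSEQ_const_iff nrm_eq_0_iff)
qed

lemma nrm_limit_le:
  assumes "(\<lambda>n. nrm (u n - l)) \<longlonglongrightarrow> 0" and "\<And>n. nrm (x - u n) \<le> B"
  shows "nrm (x - l) \<le> B"
proof -
  have "(\<lambda>n. B + nrm (u n - l)) \<longlonglongrightarrow> B + 0"
    by (intro tendsto_intros assms)
  moreover have "nrm (x - l) \<le> B + nrm (u n - l)" for n
    using nrm_diff_triangle[of x l "u n"] assms(2)[of n] by linarith
  ultimately show ?thesis
    by (simp add: LIMSEQ_le_const)
qed

text \<open>The defect is built from four values by sums, differences and scaling, all continuous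
  for the F-norm. Hence the defects of \<open>g n\<close> converge both to the defect of
  \<open>F\<close> and to 0.\<close>

lemma additive_quadratic_limit:
  assumes lim: "\<And>x z. (\<lambda>n. nrm (g n x z - F x z)) \<longlonglongrightarrow> 0"
    and defect: "\<And>x y z w. (\<lambda>n. nrm (aq_defect scale (g n) x y z w)) \<longlonglongrightarrow> 0"
  shows "additive_quadratic scale F"
  unfolding additive_quadratic_iff_defect
proof (intro allI)
  fix x y z w
  have "(\<lambda>n. nrm (aq_defect scale (g n) x y z w - aq_defect scale F x y z w)) \<longlonglongrightarrow> 0"
    unfolding aq_defect_def by (intro nrm_limit_add nrm_limit_diff nrm_limit_scale lim)
  then show "aq_defect scale F x y z w = 0"
    using nrm_limit_unique[where m = 0] defect[of x y z w] by simp
qed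

lemma additive_quadratic_zero_right:
  assumes "additive_quadratic scale F"
  shows "F x 0 = 0"
proof -
  have "F (x + 0) (0 + 0) + F (x - 0) (0 - 0) - scale 2 (F x 0) - scale 2 (F x 0) = 0"
    using assms unfolding additive_quadratic_def by blast
  then show ?thesis using scale_eq_0_iff[of 2 "F x 0"] by (simp add: scale_2 neg_eq_iff_add_eq_0)
qed

text \<open>Take \<open>y = x\<close> and \<open>w = 0\<close> in the equation; the value
  \<open>F 0 z\<close> remains. It need not vanish in general: F(x, z) = Q(z) with Q quadratic also
  solves the equation.\<close>

lemma additive_quadratic_double_left:
  assumes "additive_quadratic scale F" and "F 0 z = 0"
  shows "F (x + x) z = scale 2 (F x z)"
proof -
  have "F (x + x) (z + 0) + F (x - x) (z - 0) - scale 2 (F x z) - scale 2 (F x 0) = 0"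
    using assms unfolding additive_quadratic_def by blast
  then show ?thesis using assms by (simp add: additive_quadratic_zero_right)
qed

text \<open>Take \<open>y = 0\<close> and \<open>w = z\<close>; the second summand is then
  \<open>F x 0\<close>, which is always 0.\<close>

lemma additive_quadratic_double_right:
  assumes "additive_quadratic scale F"
  shows "F x (z + z) = scale 4 (F x z)"
proof -
  have "F (x + 0) (z + z) + F (x - 0) (z - z) - scale 2 (F x z) - scale 2 (F x z) = 0"
    using assms unfolding additive_quadratic_def by blast
  then show ?thesis using assms by (simp add: additive_quadratic_zero_right scale_2 scale_4 algebra_simps)
qed

end

lemma (in F_space) nrm_summable_limit:
  assumes step: "\<And>n. nrm (s n - s (Suc n)) \<le> a n" and a: "summable a"
  obtains l where "(\<lambda>n. nrm (s n - l)) \<longlonglongrightarrow> 0"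
proof -
  interpret M: Metric_space UNIV "\<lambda>x y. nrm (x - y)" by (rule Metric_space_nrm)
  \<comment> \<open>Each \<open>a n\<close> dominates a norm. Being nonnegative, the partial sums
    stay below the full tail.\<close>
  have a0: "a n \<ge> 0" for n
    using nrm_nonneg step order_trans by blast
  have tail: "nrm (s m - s (m + k)) \<le> (\<Sum>i. a (i + m))" for m k
    using nrm_diff_le_sum[of s a m k, OF step]
      sum_le_suminf[of "\<lambda>i. a (i + m)" "{..<k}"] a a0 by (simp add: summable_iff_shift)
  have "M.MCauchy s"
    unfolding M.MCauchy_def
  proof (intro conjI allI impI)
    fix e :: real assume "e > 0"
    then obtain N where N: "(\<Sum>i. a (i + N)) < e / 2"
      using order_tendstoD(2)[OF suminf_tail_tendsto_0[OF a], of "e / 2"]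
      by (auto simp: eventually_sequentially)
    have near: "nrm (s N - s n) < e / 2" if "N \<le> n" for n
      using tail[of N "n - N"] N that by simp
    have "nrm (s n - s n') < e" if "N \<le> n" "N \<le> n'" for n n'
      using near[OF that(1)] near[OF that(2)] nrm_diff_triangle[of "s n" "s n'" "s N"]
        nrm_minus_commute[of "s n" "s N"] by linarith
    then show "\<exists>N. \<forall>n n'. N \<le> n \<longrightarrow> N \<le> n' \<longrightarrow> nrm (s n - s n') < e" by blast
  qed auto
  then obtain l where "limitin M.mtopology s l sequentially"
    using complete unfolding M.mcomplete_def by blast
  then have "(\<lambda>n. nrm (s n - l)) \<longlonglongrightarrow> 0"
    unfolding M.limitin_metric_dist_null by simp
  then show thesis by (rule that)
qed

section \<open>Homogeneity and rescaled sequences\<close>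

context homogeneous_F_space
begin

lemma nrm_scale_power:
  assumes "b > 0"
  shows "nrm (scale (of_real b ^ n) x) = b powr (real n * \<beta>) * nrm x"
proof -
  have "(b ^ n) powr \<beta> = b powr (real n * \<beta>)"
    using assms by (simp add: powr_powr flip: powr_realpow)
  then show ?thesis using assms by (simp add: nrm_scale norm_power)
qed

text \<open>Pulling out \<open>b ^ n\<close> by homogeneity turns an approximate recursion g(n) = b
  g(n+1) into a step estimate for b^n g(n). It serves the first variable with \<open>b = 2\<close>
  and the second with \<open>b = 4\<close>.\<close>

lemma nrm_scaled_step:
  assumes "b > 0" and "nrm (scale (of_real b) (g (Suc n)) - g n) \<le> e"
  shows "nrm (scale (of_real b ^ n) (g n) - scale (of_real b ^ Suc n) (g (Suc n)))
           \<le> b powr (real n * \<beta>) * e"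
proof -
  have "nrm (scale (of_real b ^ n) (g n) - scale (of_real b ^ Suc n) (g (Suc n)))
      = nrm (scale (of_real b ^ n) (g n - scale (of_real b) (g (Suc n))))"
    by (simp add: scale_right_diff_distrib mult.commute)
  also have "\<dots> = b powr (real n * \<beta>) * nrm (g n - scale (of_real b) (g (Suc n)))"
    by (rule nrm_scale_power[OF assms(1)])
  also have "\<dots> \<le> b powr (real n * \<beta>) * e"
    using assms(2) by (intro mult_left_mono) (simp_all add: nrm_minus_commute)
  finally show ?thesis .
qed

end

section \<open>The control series under repeated halving\<close>

lemma control_term_shift:
  assumes "vector_space scl"
  shows "b powr (real m * \<beta>) * control_term scl b \<beta> \<phi> (scl (1 / 2 ^ m) x) (scl (1 / 2 ^ m) y) n
    = control_term scl b \<beta> \<phi> x y (n + m)"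
proof -
  interpret vector_space scl by fact
  show ?thesis
    by (simp add: control_term_def power_add powr_add distrib_left mult_ac)
qed

text \<open>Weights and halvings advance together, so the rescaled sum at (x/2^n, y/2^n) is the
  \<open>n\<close>-th tail of the series at (x, y).\<close>

lemma control_sum_scaled_tendsto_0:
  assumes "vector_space scl" and "summable (control_term scl b \<beta> \<phi> x y)" and "b > 0"
  shows "(\<lambda>n. b powr (real n * \<beta>) * control_sum scl b \<beta> \<phi> (scl (1 / 2 ^ n) x) (scl (1 / 2 ^ n) y))
    \<longlonglongrightarrow> 0"
proof -
  \<comment> \<open>Summability is given at (x, y) only; at the halved points it comes from the
    shifted series after cancelling the positive factor.\<close>
  have "summable (control_term scl b \<beta> \<phi> (scl (1 / 2 ^ n) x) (scl (1 / 2 ^ n) y))" for n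
  proof -
    have "summable (\<lambda>k. b powr (real n * \<beta>) *
        control_term scl b \<beta> \<phi> (scl (1 / 2 ^ n) x) (scl (1 / 2 ^ n) y) k)"
      using assms by (simp add: control_term_shift summable_iff_shift)
    then show ?thesis using assms(3) by (simp add: summable_cmult_iff)
  qed
  then have "b powr (real n * \<beta>) * control_sum scl b \<beta> \<phi> (scl (1 / 2 ^ n) x) (scl (1 / 2 ^ n) y)
      = (\<Sum>k. control_term scl b \<beta> \<phi> x y (k + n))" for n
    unfolding control_sum_def by (simp add: control_term_shift[OF assms(1)] flip: suminf_mult)
  then show ?thesis
    by (simp add: suminf_tail_tendsto_0 assms(2))
qed

lemma control_scaled_tendsto_0:
  assumes "summable (control_term scl b \<beta> \<phi> x y)"
  shows "(\<lambda>n. b powr (real n * \<beta>) * \<phi> (scl (1 / 2 ^ n) x) (scl (1 / 2 ^ n) y)) \<longlonglongrightarrow> 0"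
proof -
  \<comment> \<open>The \<open>n\<close>-th term pairs the weight b^(n \<beta>) with arguments
    halved \<open>n + 1\<close> times. One more factor b^\<beta> aligns them, and the claim follows
    after shifting the index.\<close>
  have "(\<lambda>n. b powr \<beta> * control_term scl b \<beta> \<phi> x y n) \<longlonglongrightarrow> b powr \<beta> * 0"
    by (intro tendsto_intros summable_LIMSEQ_zero assms)
  then have "(\<lambda>n. b powr (real (Suc n) * \<beta>) * \<phi> (scl (1 / 2 ^ Suc n) x) (scl (1 / 2 ^ Suc n) y))
      \<longlonglongrightarrow> 0"
    by (simp add: control_term_def powr_add distrib_left mult_ac del: power_Suc)
  then show ?thesis
    using filterlim_sequentially_Suc[of "\<lambda>n. b powr (real n * \<beta>) * \<phi> (scl (1 / 2 ^ n) x) (scl (1 / 2 ^ n) y)"]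
    by blast
qed

text \<open>Comparison of the weights; finiteness of \<Phi> thereby yields finiteness of
  \<Psi>.\<close>

lemma summable_control_term_mono:
  assumes "summable (control_term scl b \<beta> \<phi> x y)" and "0 \<le> a" "a \<le> b" "\<beta> \<ge> 0"
    and "\<And>x y. \<phi> x y \<ge> 0"
  shows "summable (control_term scl a \<beta> \<phi> x y)"
  using assms(1)
  by (rule summable_comparison_test'[where N = 0])
    (use assms in \<open>auto simp: control_term_def intro!: mult_right_mono powr_mono2\<close>)

theorem theorem3:
  fixes scaleX :: "complex \<Rightarrow> 'a::ab_group_add \<Rightarrow> 'a"
    and scaleY :: "complex \<Rightarrow> 'b::ab_group_add \<Rightarrow> 'b"
    and normX :: "'a \<Rightarrow> real" and normY :: "'b \<Rightarrow> real"
    and \<beta> :: real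
    and \<phi> :: "'a \<Rightarrow> 'a \<Rightarrow> real"
    and f :: "'a \<Rightarrow> 'a \<Rightarrow> 'b"
  assumes "\<beta> > 0"
    and "homogeneous_F_space scaleX normX \<beta>"
    and "homogeneous_F_space scaleY normY \<beta>"
    and "\<And>x y. \<phi> x y \<ge> 0"
    and "\<And>x y. summable (control_term scaleX 4 \<beta> \<phi> x y)"
    and "\<And>x. f x 0 = 0" and "\<And>z. f 0 z = 0"
    and "\<And>x y z w. normY (f (x + y) (z + w) + f (x - y) (z - w)
            - scaleY 2 (f x z) - scaleY 2 (f x w)) \<le> \<phi> x y * \<phi> z w"
  shows "\<exists>!F. additive_quadratic scaleY F \<and>
           (\<forall>x z. normY (f x z - F x z) \<le>
              min (control_sum scaleX 2 \<beta> \<phi> x x * \<phi> z 0) (\<phi> x 0 * control_sum scaleX 4 \<beta> \<phi> z z))"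
proof -
  interpret X: homogeneous_F_space scaleX normX \<beta> by fact
  interpret Y: homogeneous_F_space scaleY normY \<beta> by fact
  note \<phi>_nonneg = assms(4) and summable4 = assms(5) and f_0_right = assms(6) and f_0_left = assms(7)
  define h where "h n x = scaleX (1 / 2 ^ n) x" for n x
  have h_0: "h 0 x = x" and h_zero: "h n 0 = 0" for n x
    by (simp_all add: h_def)
  have h_double: "h (Suc n) x + h (Suc n) x = h n x" for n x
    by (simp add: h_def flip: X.scale_left_distrib)
  have h_add: "h n (x + y) = h n x + h n y" and h_diff: "h n (x - y) = h n x - h n y" for n x y
    by (simp_all add: h_def X.scale_right_distrib X.scale_right_diff_distrib)
  let ?\<Psi> = "control_sum scaleX 2 \<beta> \<phi>" and ?\<Phi> = "control_sum scaleX 4 \<beta> \<phi>"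
  have term_eq: "control_term scaleX b \<beta> \<phi> x y n = b powr (real n * \<beta>) * \<phi> (h (Suc n) x) (h (Suc n) y)"
    for b x y n by (simp add: control_term_def h_def)
  have summable2: "summable (control_term scaleX 2 \<beta> \<phi> x y)" for x y
    using summable_control_term_mono[OF summable4, of 2] assms(1) \<phi>_nonneg by simp
  have sum_le: "sum (control_term scaleX b \<beta> \<phi> x y) {..<n} \<le> control_sum scaleX b \<beta> \<phi> x y"
    if "summable (control_term scaleX b \<beta> \<phi> x y)" for b x y n
    unfolding control_sum_def
    using that by (intro sum_le_suminf) (simp_all add: control_term_def \<phi>_nonneg)
  have \<phi>_tendsto: "(\<lambda>n. b powr (real n * \<beta>) * \<phi> (h n x) (h n y)) \<longlonglongrightarrow> 0"
    if "summable (control_term scaleX b \<beta> \<phi> x y)" for b x y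
    using control_scaled_tendsto_0[OF that] by (simp add: h_def)
  have \<Psi>_tendsto: "(\<lambda>n. 2 powr (real n * \<beta>) * ?\<Psi> (h n x) (h n x)) \<longlonglongrightarrow> 0" for x
    using control_sum_scaled_tendsto_0[OF X.vector_space_axioms summable2] by (simp add: h_def)
  have defect: "normY (aq_defect scaleY f x y z w) \<le> \<phi> x y * \<phi> z w" for x y z w
    using assms(8) by (simp add: aq_defect_def)
  have double_left: "normY (f (x + x) z - scaleY 2 (f x z)) \<le> \<phi> x x * \<phi> z 0" for x z
    using defect[of x x z 0] by (simp add: aq_defect_def f_0_right f_0_left)
  have double_right: "normY (f x (z + z) - scaleY 4 (f x z)) \<le> \<phi> x 0 * \<phi> z z" for x z
    using defect[of x 0 z z]
    by (simp add: aq_defect_def f_0_right Y.scale_2 Y.scale_4 algebra_simps)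

  \<comment> \<open>Construction of \<open>F\<close> and the bound with \<Psi>\<close>
  define g where "g n x z = scaleY (2 ^ n) (f (h n x) z)" for n x z
  \<comment> \<open>Applying \<open>double_left\<close> at x/2^(n+1) and multiplying by 2^(n
    \<beta>) gives exactly the \<open>n\<close>-th term of \<Psi>(x, x) times
    \<open>\<phi> z 0\<close>.\<close>
  have g_step: "normY (g n x z - g (Suc n) x z) \<le> control_term scaleX 2 \<beta> \<phi> x x n * \<phi> z 0" for n x z
    using Y.nrm_scaled_step[of 2 "\<lambda>n. f (h n x) z" n "\<phi> (h (Suc n) x) (h (Suc n) x) * \<phi> z 0"]
      double_left[of "h (Suc n) x" z]
    by (simp add: g_def h_double term_eq Y.nrm_minus_commute mult.assoc del: power_Suc)
  have "\<exists>l. (\<lambda>n. normY (g n x z - l)) \<longlonglongrightarrow> 0" for x z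
    using Y.nrm_summable_limit[of "\<lambda>n. g n x z", OF g_step summable_mult2[OF summable2]] by blast
  then obtain F where F_lim: "(\<lambda>n. normY (g n x z - F x z)) \<longlonglongrightarrow> 0" for x z
    by metis
  have \<Psi>_bound: "normY (f x z - F x z) \<le> ?\<Psi> x x * \<phi> z 0" for x z
  proof (rule Y.nrm_limit_le[OF F_lim])
    fix n
    have "normY (f x z - g n x z) \<le> sum (control_term scaleX 2 \<beta> \<phi> x x) {..<n} * \<phi> z 0"
      using Y.nrm_diff_le_sum[of "\<lambda>n. g n x z" _ 0 n, OF g_step]
      by (simp add: g_def h_0 sum_distrib_right)
    also have "\<dots> \<le> ?\<Psi> x x * \<phi> z 0"
      by (intro mult_right_mono sum_le summable2 \<phi>_nonneg)
    finally show "normY (f x z - g n x z) \<le> ?\<Psi> x x * \<phi> z 0" .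
  qed
  have F_aq: "additive_quadratic scaleY F"
  proof (rule Y.additive_quadratic_limit[OF F_lim])
    fix x y z w
    \<comment> \<open>Only the first variable is rescaled, and halving is additive. In the resulting
      bound \<open>\<phi> z w\<close> stays fixed while the factor in \<open>x\<close> and
      \<open>y\<close> tends to 0.\<close>
    have "aq_defect scaleY (g n) x y z w = scaleY (2 ^ n) (aq_defect scaleY f (h n x) (h n y) z w)" for n
      by (simp add: aq_defect_def g_def h_add h_diff Y.scale_right_distrib
          Y.scale_right_diff_distrib mult.commute)
    then have "normY (aq_defect scaleY (g n) x y z w)
        = 2 powr (real n * \<beta>) * normY (aq_defect scaleY f (h n x) (h n y) z w)" for n
      using Y.nrm_scale_power[of 2] by simp
    then have bound: "normY (aq_defect scaleY (g n) x y z w)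
        \<le> 2 powr (real n * \<beta>) * \<phi> (h n x) (h n y) * \<phi> z w" for n
      using defect by (simp add: mult.assoc mult_left_mono)
    show "(\<lambda>n. normY (aq_defect scaleY (g n) x y z w)) \<longlonglongrightarrow> 0"
    proof (rule tendsto_sandwich[OF _ _ tendsto_const])
      show "(\<lambda>n. 2 powr (real n * \<beta>) * \<phi> (h n x) (h n y) * \<phi> z w) \<longlonglongrightarrow> 0"
        by (intro tendsto_mult_left_zero \<phi>_tendsto summable2)
    qed (use bound in \<open>auto simp: Y.nrm_nonneg\<close>)
  qed

  \<comment> \<open>The bound with \<Phi>\<close>
  have \<Phi>_bound: "normY (f x z - F x z) \<le> \<phi> x 0 * ?\<Phi> z z" for x z
  proof (rule Y.nrm_limit_le[where u = "\<lambda>n. scaleY (4 ^ n) (f x (h n z))"])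
    have F_eq: "scaleY (4 ^ n) (F x (h n z)) = F x z" for n
    proof (induction n)
      case (Suc n)
      have "scaleY (4 ^ Suc n) (F x (h (Suc n) z)) = scaleY (4 ^ n) (F x (h n z))"
        using Y.additive_quadratic_double_right[OF F_aq, of x "h (Suc n) z"]
        by (simp add: h_double mult.commute)
      then show ?case using Suc by simp
    qed (simp add: h_0)
    have "normY (scaleY (4 ^ n) (f x (h n z)) - F x z)
        = normY (scaleY (4 ^ n) (f x (h n z) - F x (h n z)))" for n
      by (simp add: F_eq Y.scale_right_diff_distrib)
    then have "normY (scaleY (4 ^ n) (f x (h n z)) - F x z)
        = 4 powr (real n * \<beta>) * normY (f x (h n z) - F x (h n z))" for n
      using Y.nrm_scale_power[of 4] by simp
    \<comment> \<open>The \<Psi>-bound at (x, z/2^n) contributes \<phi>(z/2^n, 0). Writing 0 as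
      \<open>h n 0\<close> makes the last factor an instance of \<open>\<phi>_tendsto\<close> at (z,
      0), where the base 4 is available.\<close>
    then have bound: "normY (scaleY (4 ^ n) (f x (h n z)) - F x z)
        \<le> ?\<Psi> x x * (4 powr (real n * \<beta>) * \<phi> (h n z) (h n 0))" for n
      using mult_left_mono[OF \<Psi>_bound[of x "h n z"], of "4 powr (real n * \<beta>)"]
      by (simp add: h_zero mult_ac)
    show "(\<lambda>n. normY (scaleY (4 ^ n) (f x (h n z)) - F x z)) \<longlonglongrightarrow> 0"
    proof (rule tendsto_sandwich[OF _ _ tendsto_const])
      show "(\<lambda>n. ?\<Psi> x x * (4 powr (real n * \<beta>) * \<phi> (h n z) (h n 0))) \<longlonglongrightarrow> 0"
        by (intro tendsto_mult_right_zero \<phi>_tendsto summable4)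
    qed (use bound in \<open>auto simp: Y.nrm_nonneg\<close>)
  next
    fix n
    \<comment> \<open>Here \<open>double_right\<close> at z/2^(n+1) supplies the \<open>n\<close>-th
      term of \<Phi>(z, z), with \<open>\<phi> x 0\<close> as constant factor.\<close>
    have "normY (scaleY (4 ^ n) (f x (h n z)) - scaleY (4 ^ Suc n) (f x (h (Suc n) z)))
        \<le> \<phi> x 0 * control_term scaleX 4 \<beta> \<phi> z z n" for n
      using Y.nrm_scaled_step[of 4 "\<lambda>n. f x (h n z)" n "\<phi> x 0 * \<phi> (h (Suc n) z) (h (Suc n) z)"]
        double_right[of x "h (Suc n) z"]
      by (simp add: h_double term_eq Y.nrm_minus_commute mult_ac del: power_Suc)
    from Y.nrm_diff_le_sum[of "\<lambda>n. scaleY (4 ^ n) (f x (h n z))" _ 0 n, OF this]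
    have "normY (f x z - scaleY (4 ^ n) (f x (h n z))) \<le> \<phi> x 0 * sum (control_term scaleX 4 \<beta> \<phi> z z) {..<n}"
      by (simp add: h_0 sum_distrib_left)
    also have "\<dots> \<le> \<phi> x 0 * ?\<Phi> z z"
      by (intro mult_left_mono sum_le summable4 \<phi>_nonneg)
    finally show "normY (f x z - scaleY (4 ^ n) (f x (h n z))) \<le> \<phi> x 0 * ?\<Phi> z z" .
  qed

  \<comment> \<open>Summability of \<open>4\<^bsup>n\<beta>\<^esup> \<phi>(0, 0)\<close> forces \<open>\<phi>(0, 0) = 0\<close>; without this, a competitor could
    differ from \<open>F\<close> by a quadratic function of \<open>z\<close> alone.\<close>
  have "\<phi> 0 0 = 0"
  proof -
    have "(\<lambda>n. 4 powr (real n * \<beta>) * \<phi> 0 0) \<longlonglongrightarrow> 0"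
      using \<phi>_tendsto[OF summable4, of 0 0] by (simp add: h_zero)
    moreover have "\<phi> 0 0 \<le> 4 powr (real n * \<beta>) * \<phi> 0 0" for n
      using assms(1) mult_right_mono[OF ge_one_powr_ge_zero \<phi>_nonneg, of 4 "real n * \<beta>" 0 0] by simp
    ultimately have "\<phi> 0 0 \<le> 0"
      by (simp add: LIMSEQ_le_const)
    then show ?thesis using \<phi>_nonneg[of 0 0] by simp
  qed
  then have \<Psi>_0: "?\<Psi> 0 0 = 0"
    by (simp add: control_sum_def term_eq h_zero)

  \<comment> \<open>Uniqueness\<close>
  have unique: "H = F" if H_aq: "additive_quadratic scaleY H"
    and H_bound: "\<And>x z. normY (f x z - H x z) \<le> ?\<Psi> x x * \<phi> z 0" for H
  proof (intro ext)
    fix x z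
    \<comment> \<open>Since \<Psi>(0, 0) = 0 and f(0, z) = 0, the bound forces H(0, z) = 0; this is
      what makes \<open>H\<close> exactly homogeneous under doubling of \<open>x\<close>.\<close>
    have "normY (f 0 z - H 0 z) \<le> 0"
      using H_bound[of 0 z] by (simp add: \<Psi>_0)
    then have H_0: "H 0 z = 0"
      using Y.nrm_nonneg[of "f 0 z - H 0 z"] by (simp add: f_0_left Y.nrm_eq_0_iff Y.nrm_uminus)
    have H_eq: "scaleY (2 ^ n) (H (h n x) z) = H x z" for n
    proof (induction n)
      case (Suc n)
      have "scaleY (2 ^ Suc n) (H (h (Suc n) x) z) = scaleY (2 ^ n) (H (h n x) z)"
        using Y.additive_quadratic_double_left[OF H_aq H_0, of "h (Suc n) x"]
        by (simp add: h_double mult.commute)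
      then show ?case using Suc by simp
    qed (simp add: h_0)
    have "normY (g n x z - H x z) = normY (scaleY (2 ^ n) (f (h n x) z - H (h n x) z))" for n
      by (simp add: H_eq g_def Y.scale_right_diff_distrib)
    then have "normY (g n x z - H x z) = 2 powr (real n * \<beta>) * normY (f (h n x) z - H (h n x) z)" for n
      using Y.nrm_scale_power[of 2] by simp
    then have bound: "normY (g n x z - H x z)
        \<le> 2 powr (real n * \<beta>) * ?\<Psi> (h n x) (h n x) * \<phi> z 0" for n
      using H_bound by (simp add: mult.assoc mult_left_mono)
    have "(\<lambda>n. normY (g n x z - H x z)) \<longlonglongrightarrow> 0"
    proof (rule tendsto_sandwich[OF _ _ tendsto_const])
      show "(\<lambda>n. 2 powr (real n * \<beta>) * ?\<Psi> (h n x) (h n x) * \<phi> z 0) \<longlonglongrightarrow> 0"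
        by (intro tendsto_mult_left_zero \<Psi>_tendsto)
    qed (use bound in \<open>auto simp: Y.nrm_nonneg\<close>)
    then show "H x z = F x z"
      by (rule Y.nrm_limit_unique[where u = "\<lambda>n. g n x z", OF _ F_lim[of x z]])
  qed
  show ?thesis
  proof (rule ex1I[of _ F])
    show "additive_quadratic scaleY F \<and> (\<forall>x z. normY (f x z - F x z) \<le>
        min (?\<Psi> x x * \<phi> z 0) (\<phi> x 0 * ?\<Phi> z z))"
      by (simp add: F_aq \<Psi>_bound \<Phi>_bound)
  qed (rule unique, simp_all)
qed

end
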